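(* For $k,\ell\in\mathbb{Z}^+$, let $a_1,\dots,a_k,b_1,\dots,b_\ell\in\mathbb{Z}^+$. Assume $\sum_{i=1}^k a_i\ge\sum_{i=1}^\ell b_i$. Then $$RR\left(x+\sum_{i=1}^k a_iy_i=z,\; x+\sum_{i=1}^\ell b_iy_i=z\right)=\begin{cases}\displaystyle 2\sum_{i=1}^k a_i+2\left\lfloor\frac{\sum_{i=1}^k a_i+1}{2}\right\rfloor+1 & \text{for } \sum_{i=1}^\ell b_i=1,\\[2ex] \displaystyle\left(\sum_{i=1}^k a_i+1\right)\left(\sum_{i=1}^\ell b_i+1\right)+\sum_{i=1}^\ell b_i & \text{for } \sum_{i=1}^\ell b_i\ge 2.\end{cases}$$
   Context: For two linear homogeneous equations $\mathcal{E},\mathcal{E}'$ with integer coefficients, each in at least three variables, $RR(\mathcal{E},\mathcal{E}')$ denotes the minimum integer $N$, if it exists, such that any $2$-coloring of $[1,N]=\{1,2,\dots,N\}$ admits either a solution to $\mathcal{E}$ with all entries in $[1,N]$ and of the first color, or a solution to $\mathcal{E}'$ with all entries in $[1,N]$ and of the second color. Entries of solutions need not be distinct. Here the first equation is in the variables $x,y_1,\dots,y_k,z$ and the second in the variables $x,y_1,\dots,y_\ell,z$. *)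

theory Defs
  imports Main
begin

(* A linear homogeneous equation c_1 v_1 + ... + c_n v_n = 0 with integer coefficients is
   represented by its coefficient list [c_1, ..., c_n]. Entries of a solution may coincide. *)

definition solution :: "int list \<Rightarrow> int list \<Rightarrow> bool" where
  "solution cs vs \<longleftrightarrow> length vs = length cs \<and> (\<Sum>i<length cs. cs ! i * vs ! i) = 0"

(* A colouring is a predicate (True: first colour, False: second colour); only its values on
   [1,N] matter. *)

definition rado_property :: "int list \<Rightarrow> int list \<Rightarrow> nat \<Rightarrow> bool" where
  "rado_property cs ds N \<longleftrightarrow>
     (\<forall>\<chi> :: int \<Rightarrow> bool.
        (\<exists>vs. solution cs vs \<and> set vs \<subseteq> {1..int N} \<and> (\<forall>v\<in>set vs. \<chi> v)) \<or>
        (\<exists>vs. solution ds vs \<and> set vs \<subseteq> {1..int N} \<and> (\<forall>v\<in>set vs. \<not> \<chi> v)))"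

definition RR :: "int list \<Rightarrow> int list \<Rightarrow> nat option" where
  "RR cs ds =
     (if \<exists>N. rado_property cs ds N then Some (LEAST N. rado_property cs ds N) else None)"

(* x + a_1 y_1 + ... + a_k y_k = z, with the variables ordered x, y_1, ..., y_k, z *)

definition sum_eq :: "nat \<Rightarrow> (nat \<Rightarrow> nat) \<Rightarrow> int list" where
  "sum_eq k a = 1 # map (\<lambda>i. int (a i)) [1..<Suc k] @ [- 1]"

end

theory Submission
  imports Defs
begin

text \<open>
  Write \<open>A\<close> and \<open>B\<close> for the two coefficient sums. Setting all \<open>y\<^sub>i\<close> equal shows that a colouring
  without solutions also avoids \<open>x + A y = z\<close> in the first colour and \<open>x + B y = z\<close> in the second, and
  the upper bounds already hold for these three-variable equations. For \<open>B \<ge> 2\<close> the colour of \<open>1\<close>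
  forces the opposite colour on \<open>2\<close>. Then translations by \<open>B\<close> and \<open>2A\<close> (or by \<open>A\<close> and \<open>2B\<close>, if \<open>1\<close> has
  the first colour) switch colours, whereas, whichever colour \<open>4\<close> has, a translation by \<open>4A\<close> or \<open>4B\<close>,
  an even number of such switches, would also have to switch a colour. The case \<open>B = 2\<close>, where the
  interval is too short for the translations by \<open>4A\<close>, is settled by a few more forced values.
  For \<open>B = 1\<close>, all odd numbers up to about \<open>A + 1\<close> are forced into the second colour together with
  \<open>2A + 2\<close>, which is a sum of two of them.
\<close>

section \<open>Solutions of the equations\<close>

lemma solution_sum_eq:
  "solution (sum_eq k a) (x # map y [1..<Suc k] @ [z]) \<longleftrightarrow>
     x + (\<Sum>i=1..k. int (a i) * y i) = z"
proof -
  have "(\<Sum>i<k + 2. sum_eq k a ! i * (x # map y [1..<Suc k] @ [z]) ! i) =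
      x + (\<Sum>i<k. int (a (Suc i)) * y (Suc i)) - z"
    unfolding add_2_eq_Suc'
    by (subst sum.lessThan_Suc, subst sum.lessThan_Suc_shift)
       (simp add: sum_eq_def nth_append del: upt_Suc)
  also have "(\<Sum>i<k. int (a (Suc i)) * y (Suc i)) = (\<Sum>i=1..k. int (a i) * y i)"
    by (simp add: sum.atLeast1_atMost_eq)
  finally show ?thesis
    by (simp add: solution_def sum_eq_def del: upt_Suc)
qed

lemma ex_solution_sum_eq_iff:
  "(\<exists>vs. solution (sum_eq k a) vs \<and> (\<forall>v\<in>set vs. P v)) \<longleftrightarrow>
     (\<exists>x y. P x \<and> (\<forall>i\<in>{1..k}. P (y i)) \<and> P (x + (\<Sum>i=1..k. int (a i) * y i)))"
proof
  assume "\<exists>vs. solution (sum_eq k a) vs \<and> (\<forall>v\<in>set vs. P v)"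
  then obtain vs where vs: "solution (sum_eq k a) vs" "\<forall>v\<in>set vs. P v"
    by blast
  \<comment> \<open>Position 0 holds x, positions 1 to \<open>k\<close> hold the y_i, and position
    \<open>Suc k\<close> holds z.\<close>
  define y where "y i = vs ! i" for i
  have len: "length vs = k + 2"
    using vs(1) by (simp add: solution_def sum_eq_def)
  have eq: "vs = y 0 # map y [1..<Suc k] @ [y (Suc k)]"
    by (rule nth_equalityI)
       (auto simp: len y_def nth_append nth_Cons less_Suc_eq_le le_Suc_eq
             simp del: upt_Suc split: nat.splits)
  then have "y 0 + (\<Sum>i=1..k. int (a i) * y i) = y (Suc k)"
    using vs(1) solution_sum_eq by metis
  moreover have "P (y i)" if "i \<le> Suc k" for i
    using vs(2) that by (auto simp: y_def len)
  ultimately show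
    "\<exists>x y. P x \<and> (\<forall>i\<in>{1..k}. P (y i)) \<and> P (x + (\<Sum>i=1..k. int (a i) * y i))"
    by (intro exI[of _ "y 0"] exI[of _ y]) auto
next
  assume "\<exists>x y. P x \<and> (\<forall>i\<in>{1..k}. P (y i)) \<and> P (x + (\<Sum>i=1..k. int (a i) * y i))"
  then obtain x y where "P x" "\<forall>i\<in>{1..k}. P (y i)" "P (x + (\<Sum>i=1..k. int (a i) * y i))"
    by blast
  then show "\<exists>vs. solution (sum_eq k a) vs \<and> (\<forall>v\<in>set vs. P v)"
    by (intro exI[of _ "x # map y [1..<Suc k] @ [x + (\<Sum>i=1..k. int (a i) * y i)]"])
       (auto simp: solution_sum_eq simp del: upt_Suc One_nat_def)
qed

text \<open>With z eliminated and the colour class left as a parameter, one notion serves both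
  equations and both colours.\<close>

definition has_sol :: "nat \<Rightarrow> (nat \<Rightarrow> nat) \<Rightarrow> nat \<Rightarrow> (int \<Rightarrow> bool) \<Rightarrow> bool" where
  "has_sol k a N P \<longleftrightarrow>
     (\<exists>x y. (\<forall>v\<in>{x, x + (\<Sum>i=1..k. int (a i) * y i)} \<union> y ` {1..k}. 1 \<le> v \<and> v \<le> int N \<and> P v))"

lemma rado_property_sum_eq_iff:
  "rado_property (sum_eq k a) (sum_eq l b) N \<longleftrightarrow>
     (\<forall>\<chi>. has_sol k a N \<chi> \<or> has_sol l b N (\<lambda>v. \<not> \<chi> v))"
proof -
  have "(\<exists>vs. solution (sum_eq k a) vs \<and> set vs \<subseteq> {1..int N} \<and> (\<forall>v\<in>set vs. P v)) \<longleftrightarrow>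
      has_sol k a N P" for k a P
  proof -
    have "(\<exists>vs. solution (sum_eq k a) vs \<and> set vs \<subseteq> {1..int N} \<and> (\<forall>v\<in>set vs. P v)) \<longleftrightarrow>
        (\<exists>vs. solution (sum_eq k a) vs \<and> (\<forall>v\<in>set vs. 1 \<le> v \<and> v \<le> int N \<and> P v))"
      by (intro ex_cong1) auto
    also have "\<dots> \<longleftrightarrow> has_sol k a N P"
      unfolding ex_solution_sum_eq_iff has_sol_def by (intro ex_cong1) auto
    finally show ?thesis .
  qed
  then show ?thesis
    by (simp add: rado_property_def)
qed

lemma has_solE:
  assumes "has_sol k a N P"
  obtains x y where "1 \<le> x" "P x" "\<And>i. i \<in> {1..k} \<Longrightarrow> 1 \<le> y i" "\<And>i. i \<in> {1..k} \<Longrightarrow> P (y i)"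
    "x + (\<Sum>i=1..k. int (a i) * y i) \<le> int N" "P (x + (\<Sum>i=1..k. int (a i) * y i))"
  using assms unfolding has_sol_def by blast

lemma RR_eqI:
  assumes "rado_property cs ds N" and "\<And>n. rado_property cs ds n \<Longrightarrow> N \<le> n"
  shows "RR cs ds = Some N"
  using assms by (auto simp: RR_def intro: Least_equality)

lemma weighted_sum_ge:
  fixes y :: "nat \<Rightarrow> int"
  assumes "\<And>i. i \<in> {1..k} \<Longrightarrow> c \<le> y i"
  shows "int (\<Sum>i=1..k. a i) * c \<le> (\<Sum>i=1..k. int (a i) * y i)"
  using assms by (auto simp: sum_distrib_right intro!: sum_mono mult_left_mono)

text \<open>Raising entry \<open>j\<close> from \<open>c\<close> to \<open>y j\<close> adds at least
  the difference, as its coefficient is at least 1. Hence a single large entry pushes z out of the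
  interval.\<close>

lemma weighted_sum_ge_large_entry:
  fixes y :: "nat \<Rightarrow> int"
  assumes y: "\<And>i. i \<in> {1..k} \<Longrightarrow> c \<le> y i" and j: "j \<in> {1..k}" "a j > 0"
  shows "int (\<Sum>i=1..k. a i) * c + (y j - c) \<le> (\<Sum>i=1..k. int (a i) * y i)"
proof -
  have "y j - c \<le> int (a j) * (y j - c)"
    using y[OF j(1)] j(2) mult_right_mono[of 1 "int (a j)" "y j - c"] by simp
  also have "\<dots> \<le> (\<Sum>i=1..k. int (a i) * (y i - c))"
    using y j(1) by (intro member_le_sum) auto
  also have "\<dots> = (\<Sum>i=1..k. int (a i) * y i) - int (\<Sum>i=1..k. a i) * c"
    by (simp add: right_diff_distrib sum_subtractf sum_distrib_right)
  finally show ?thesis by simp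
qed

lemma weighted_sum_le:
  fixes y :: "nat \<Rightarrow> int"
  assumes "\<And>i. i \<in> {1..k} \<Longrightarrow> y i \<le> c"
  shows "(\<Sum>i=1..k. int (a i) * y i) \<le> int (\<Sum>i=1..k. a i) * c"
  using assms by (auto simp: sum_distrib_right intro!: sum_mono mult_left_mono)

section \<open>Lower bounds\<close>

text \<open>The middle block from \<open>B + 1\<close> to \<open>M - 1\<close>, with
  \<open>M = (A + 1) * (B + 1)\<close>, gets the first colour. Its elements produce only z \<ge> M.
  In the second colour, an x or y_i from the upper block forces z \<ge> M + B > N, while entries
  from the lower block give a z in the middle block.\<close>

lemma rado_property_ge:
  assumes b: "\<And>i. i \<in> {1..l} \<Longrightarrow> b i > 0"
    and A: "A = (\<Sum>i=1..k. a i)" and B: "B = (\<Sum>i=1..l. b i)" and AB: "B \<le> A"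
    and rado: "rado_property (sum_eq k a) (sum_eq l b) N"
  shows "(A + 1) * (B + 1) + B \<le> N"
proof (rule ccontr)
  assume "\<not> (A + 1) * (B + 1) + B \<le> N"
  then have "int N < int ((A + 1) * (B + 1) + B)"
    by (simp only: of_nat_less_iff not_le)
  then have N: "int N < (int A + 1) * (int B + 1) + int B"
    by (simp add: algebra_simps)
  define M where "M = (int A + 1) * (int B + 1)"
  define \<chi> where "\<chi> v \<longleftrightarrow> int B < v \<and> v < M" for v
  from rado consider "has_sol k a N \<chi>" | "has_sol l b N (\<lambda>v. \<not> \<chi> v)"
    by (auto simp: rado_property_sum_eq_iff)
  then show False
  proof cases
    case 1
    then obtain x y where x: "1 \<le> x" "\<chi> x"
      and y: "\<And>i. i \<in> {1..k} \<Longrightarrow> 1 \<le> y i" "\<And>i. i \<in> {1..k} \<Longrightarrow> \<chi> (y i)"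
      and z: "x + (\<Sum>i=1..k. int (a i) * y i) \<le> int N" "\<chi> (x + (\<Sum>i=1..k. int (a i) * y i))"
      by (rule has_solE) blast
    have "int B + 1 \<le> y i" if "i \<in> {1..k}" for i
      using y(2)[OF that] by (simp add: \<chi>_def)
    then have "int A * (int B + 1) \<le> (\<Sum>i=1..k. int (a i) * y i)"
      unfolding A by (rule weighted_sum_ge)
    then show False
      using x z by (simp add: \<chi>_def M_def algebra_simps)
  next
    case 2
    then obtain x y where x: "1 \<le> x" "\<not> \<chi> x"
      and y: "\<And>i. i \<in> {1..l} \<Longrightarrow> 1 \<le> y i" "\<And>i. i \<in> {1..l} \<Longrightarrow> \<not> \<chi> (y i)"
      and z: "x + (\<Sum>i=1..l. int (b i) * y i) \<le> int N" "\<not> \<chi> (x + (\<Sum>i=1..l. int (b i) * y i))"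
      by (rule has_solE) blast
    have ge: "int B \<le> (\<Sum>i=1..l. int (b i) * y i)"
      using weighted_sum_ge[of l 1 y b] y(1) by (simp add: B)
    have "x \<le> int B"
      using x(2) z(1) ge N by (simp add: \<chi>_def M_def)
    moreover have "y j \<le> int B" if j: "j \<in> {1..l}" for j
    proof -
      have "int B * 1 + (y j - 1) \<le> (\<Sum>i=1..l. int (b i) * y i)"
        unfolding B using y(1) j b[OF j] by (intro weighted_sum_ge_large_entry) auto
      then have "y j < M"
        using x(1) z(1) N by (simp add: M_def)
      then show ?thesis
        using y(2)[OF j] by (simp add: \<chi>_def)
    qed
    then have "(\<Sum>i=1..l. int (b i) * y i) \<le> int B * int B"
      using weighted_sum_le[of l y "int B" b] by (simp add: B)
    \<comment> \<open>\<open>B \<le> A\<close> keeps z \<le> B + B * B below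
      \<open>M\<close>.\<close>
    moreover have "int B * int B \<le> int A * int B"
      using AB by (intro mult_right_mono) auto
    moreover have "M = int A * int B + int A + int B + 1"
      by (simp add: M_def algebra_simps)
    ultimately show False
      using z(2) ge x(1) AB unfolding \<chi>_def by linarith
  qed
qed

text \<open>The second colour consists of the odd numbers below \<open>2 * m\<close> and the even
  numbers above \<open>2 * A\<close>, where m = (A + 1) div 2. First-colour numbers are at least 2,
  so z > 2A must be odd; then some entry is odd, hence above \<open>2 * m\<close>, and z leaves the
  interval. In the second colour, two odd numbers have an even sum \<le> 4m - 2 \<le> 2A.\<close>

lemma rado_property_ge_Schur:
  assumes a: "\<And>i. i \<in> {1..k} \<Longrightarrow> a i > 0" and k: "k \<ge> 1" and l: "l = 1" "b 1 = 1"
    and A: "A = (\<Sum>i=1..k. a i)"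
    and rado: "rado_property (sum_eq k a) (sum_eq l b) N"
  shows "2 * A + 2 * ((A + 1) div 2) + 1 \<le> N"
proof (rule ccontr)
  define m where "m = int ((A + 1) div 2)"
  assume "\<not> 2 * A + 2 * ((A + 1) div 2) + 1 \<le> N"
  then have N: "int N \<le> 2 * int A + 2 * m"
    unfolding m_def by linarith
  have "a 1 \<le> A"
    unfolding A using k by (intro member_le_sum) auto
  then have m: "1 \<le> m" "2 * m \<le> int A + 1"
    using a[of 1] k by (auto simp: m_def)
  define \<chi> where "\<chi> v \<longleftrightarrow> (if odd v then 2 * m < v else v \<le> 2 * int A)" for v
  from rado consider "has_sol k a N \<chi>" | "has_sol l b N (\<lambda>v. \<not> \<chi> v)"
    by (auto simp: rado_property_sum_eq_iff)
  then show False
  proof cases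
    case 1
    then obtain x y where x: "1 \<le> x" "\<chi> x"
      and y: "\<And>i. i \<in> {1..k} \<Longrightarrow> 1 \<le> y i" "\<And>i. i \<in> {1..k} \<Longrightarrow> \<chi> (y i)"
      and z: "x + (\<Sum>i=1..k. int (a i) * y i) \<le> int N" "\<chi> (x + (\<Sum>i=1..k. int (a i) * y i))"
      by (rule has_solE) blast
    have ge2: "2 \<le> v" if "\<chi> v" "1 \<le> v" for v
      using that m by (cases "v = 1") (auto simp: \<chi>_def)
    have y2: "2 \<le> y i" if "i \<in> {1..k}" for i
      using ge2 y that by blast
    have ge: "2 * int A \<le> (\<Sum>i=1..k. int (a i) * y i)"
      using weighted_sum_ge[of k 2 y a] y2 by (simp add: A)
    have "\<not> x + (\<Sum>i=1..k. int (a i) * y i) \<le> 2 * int A"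
      using ge ge2[OF x(2,1)] by linarith
    then have "odd (x + (\<Sum>i=1..k. int (a i) * y i))"
      using z(2) unfolding \<chi>_def by argo
    moreover have "even x"
    proof (rule ccontr)
      assume "odd x"
      then have "2 * m < x"
        using x by (simp add: \<chi>_def)
      then show False
        using ge z(1) N by linarith
    qed
    ultimately have "odd (\<Sum>i=1..k. int (a i) * y i)"
      by simp
    then obtain j where j: "j \<in> {1..k}" "odd (y j)"
      by (metis (no_types, lifting) dvd_mult dvd_sum)
    then have "2 * m < y j"
      using y(2)[OF j(1)] by (simp add: \<chi>_def)
    \<comment> \<open>Here z \<ge> 2 + 2A + (2m + 1 - 2) > N.\<close>
    then show False
      using weighted_sum_ge_large_entry[of k 2 y j a, OF y2 j(1) a[OF j(1)]] z(1) N ge2[OF x(2,1)]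
      unfolding A by linarith
  next
    case 2
    then obtain x y where x: "1 \<le> x" "\<not> \<chi> x"
      and y: "\<And>i. i \<in> {1..l} \<Longrightarrow> 1 \<le> y i" "\<And>i. i \<in> {1..l} \<Longrightarrow> \<not> \<chi> (y i)"
      and z: "x + (\<Sum>i=1..l. int (b i) * y i) \<le> int N" "\<not> \<chi> (x + (\<Sum>i=1..l. int (b i) * y i))"
      by (rule has_solE) blast
    have y1: "1 \<le> y 1" "\<not> \<chi> (y 1)" "x + y 1 \<le> int N" "\<not> \<chi> (x + y 1)"
      using y z l by simp_all
    have "x + y 1 \<le> 2 * int A" if odd: "odd x" "odd (y 1)"
    proof -
      obtain p q where pq: "x = 2 * p + 1" "y 1 = 2 * q + 1"
        using odd by (meson oddE)
      then have "p < m" "q < m"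
        using x(2) y1(2) odd unfolding \<chi>_def by simp_all
      then show ?thesis
        unfolding pq using m by linarith
    qed
    \<comment> \<open>Odd plus even is odd and above 2A, so it has the first colour; even plus even
      is at least 4A + 4 > N.\<close>
    then show False
      using x y1 N m unfolding \<chi>_def by (cases "even x"; cases "even (y 1)"; simp)
  qed
qed

section \<open>Upper bounds for three variables\<close>

text \<open>Upper bounds on \<open>x\<close> and \<open>y\<close> are implicit in
  \<open>x + A * y \<le> N\<close> when \<open>A \<ge> 1\<close>.\<close>

definition avoids :: "int \<Rightarrow> int \<Rightarrow> (int \<Rightarrow> bool) \<Rightarrow> bool" where
  "avoids N A P \<longleftrightarrow> (\<forall>x y. 1 \<le> x \<and> 1 \<le> y \<and> x + A * y \<le> N \<and> P x \<and> P y \<longrightarrow> \<not> P (x + A * y))"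

lemma avoidsD:
  assumes "avoids N A P" "P x" "P y" "z = x + A * y" "1 \<le> x" "1 \<le> y" "z \<le> N"
  shows "\<not> P z"
  using assms by (auto simp: avoids_def)

lemma not_avoids_both_one_second:
  fixes A B :: int
  assumes AB: "2 \<le> B" "B \<le> A" and N: "N = (A + 1) * (B + 1) + B"
    and T: "avoids N A c" and F: "avoids N B (\<lambda>v. \<not> c v)" and 1: "\<not> c 1"
  shows False
proof -
  \<comment> \<open>Naming the product makes the range checks linear in \<open>Q\<close>,
    \<open>A\<close> and \<open>B\<close>.\<close>
  define Q where "Q = A * B"
  have Q: "A * B = Q" "B * A = Q"
    by (simp_all add: Q_def)
  have N': "N = Q + A + 2 * B + 1"
    by (simp add: N Q_def algebra_simps)
  note eqs = Q algebra_simps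
  have P: "2 * A \<le> Q" "2 * B \<le> Q"
    using AB mult_left_mono[of 2 B A] mult_right_mono[of 2 A B] by (auto simp: Q)
  note Td = avoidsD[OF T] and Fd = avoidsD[OF F, simplified not_not]
  note bd = N' P AB
  \<comment> \<open>The chain 1, B + 1, (A + 1)(B + 1), N alternates in colour and uses the whole
    interval. The identities N = (2B + 1) + A(B + 1) and 2B + 1 = 1 + B * 2 then carry the
    information down to 2.\<close>
  have t1: "c (B + 1)"
    by (rule Fd[OF 1 1]) (use bd in \<open>simp_all add: eqs\<close>)
  have f2: "\<not> c ((A + 1) * (B + 1))"
    by (rule Td[OF t1 t1]) (use bd in \<open>simp_all add: eqs\<close>)
  have t3: "c N"
    by (rule Fd[OF f2 1]) (use bd in \<open>simp_all add: eqs\<close>)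
  have f4: "\<not> c (2 * B + 1)"
    using Td[OF _ t1, of "2 * B + 1" N] t3 bd by (auto simp: eqs)
  have t2: "c 2"
    using Fd[OF 1, of 2 "2 * B + 1"] f4 bd by (auto simp: eqs)
  have FB: "c (v + B)" if "\<not> c v" "1 \<le> v" "v + B \<le> N" for v
    by (rule Fd[OF that(1) 1]) (use that in auto)
  have TA: "\<not> c (v + 2 * A)" if "c v" "1 \<le> v" "v + 2 * A \<le> N" for v
    by (rule Td[OF that(1) t2]) (use that in auto)
  \<comment> \<open>The route +B, +2A, +B gives v + 2B + 2A the first colour, whereas a first-colour
    v + 2B would give it the second.\<close>
  have F2B: "\<not> c (v + 2 * B)" if v: "\<not> c v" "1 \<le> v" "v + 2 * B + 2 * A \<le> N" for v
  proof
    assume "c (v + 2 * B)"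
    then have "\<not> c (v + 2 * B + 2 * A)"
      using v AB by (intro TA) auto
    moreover have "c (v + B)"
      using v AB by (intro FB) auto
    then have "\<not> c (v + B + 2 * A)"
      using v AB by (intro TA) auto
    then have "c (v + B + 2 * A + B)"
      using v AB by (intro FB) auto
    ultimately show False
      by (simp add: algebra_simps)
  qed
  show False
  proof (cases "B = 2")
    case True
    \<comment> \<open>Now N = 3A + 5. Since 4 + 3A = (2 + 3A) + 2 has the first colour, as does 3,
      the colour of 4 is forced.\<close>
    have "\<not> c (2 + A * (B + 1))"
      by (rule Td[OF t2 t1]) (use bd in \<open>simp_all add: eqs\<close>)
    then have "c (2 + A * (B + 1) + B)"
      by (rule FB) (use bd in \<open>simp_all add: eqs\<close>)
    then have f: "\<not> c 4"
      using Td[OF _ t1, of 4 "2 + A * (B + 1) + B"] AB by (auto simp: N True)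
    have t6: "c 6"
      using FB[OF f] AB by (simp add: N True)
    have t9: "c 9"
      using Fd[OF 1 f, of 9] AB by (simp add: N True)
    \<comment> \<open>The contradictions come from 6 = 2 + 2A, from 9 = 3 + 2A, and from 9 = 5 + 2B;
      the last shift needs 9 + 2A \<le> N, that is, A \<ge> 4.\<close>
    consider "A = 2" | "A = 3" | "A \<ge> 4"
      using AB True by linarith
    then show False
    proof cases
      case 1
      then show False using TA[OF t2] t6 by (simp add: N True)
    next
      case 2
      then show False using TA[OF t1] t9 by (simp add: N True)
    next
      case 3
      then show False using F2B[OF f4] t9 by (simp add: N True)
    qed
  next
    case False
    then have B: "3 \<le> B" using AB by simp
    have P: "3 * A \<le> Q"
      using AB B mult_left_mono[of 3 B A] by (auto simp: Q)
    note bd = N' P AB B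
    \<comment> \<open>4B + 1 = 1 + B * 4 has the second colour, so 4 cannot have it.\<close>
    have "\<not> c (2 * B + 1 + 2 * B)"
      by (rule F2B[OF f4]) (use bd in \<open>simp_all add: eqs\<close>)
    then have t4: "c 4"
      using Fd[OF 1, of 4 "4 * B + 1"] bd by (auto simp: eqs)
    \<comment> \<open>Two routes from 2 to 2 + 4A + B conflict: +4A, +B against +2A, +B,
      +2A.\<close>
    have "\<not> c (2 + 4 * A)"
      by (rule Td[OF t2 t4]) (use bd in \<open>simp_all add: eqs\<close>)
    then have "c (2 + 4 * A + B)"
      by (rule FB) (use bd in \<open>simp_all add: eqs\<close>)
    moreover have "\<not> c (2 + 2 * A)"
      by (rule TA[OF t2]) (use bd in \<open>simp_all add: eqs\<close>)
    then have "c (2 + 2 * A + B)"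
      by (rule FB) (use bd in \<open>simp_all add: eqs\<close>)
    then have "\<not> c (2 + 2 * A + B + 2 * A)"
      by (rule TA) (use bd in \<open>simp_all add: eqs\<close>)
    ultimately show False
      by (simp add: algebra_simps)
  qed
qed

lemma not_avoids_both_one_first:
  fixes A B :: int
  assumes AB: "2 \<le> B" "B \<le> A" and N: "N = (A + 1) * (B + 1) + B"
    and T: "avoids N A c" and F: "avoids N B (\<lambda>v. \<not> c v)" and 1: "c 1"
  shows False
proof -
  define Q where "Q = A * B"
  have Q: "A * B = Q" "B * A = Q"
    by (simp_all add: Q_def)
  have N': "N = Q + A + 2 * B + 1"
    by (simp add: N Q_def algebra_simps)
  note eqs = Q algebra_simps
  have P: "2 * A \<le> Q" "2 * B \<le> Q" "B * B \<le> Q"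
    using AB mult_left_mono[of 2 B A] mult_right_mono[of 2 A B] mult_right_mono[of B A B] by (auto simp: Q)
  \<comment> \<open>This is (B - 1)(A - B) \<ge> 0, which is exactly what puts 2A + 1 + B(B + 1)
    inside the interval.\<close>
  have P': "A + B * B \<le> Q + B"
    using AB mult_left_mono[of B A "B - 1"] by (auto simp: eqs)
  note Td = avoidsD[OF T] and Fd = avoidsD[OF F, simplified not_not]
  note bd = N' P P' AB
  have TA: "\<not> c (v + A)" if "c v" "1 \<le> v" "v + A \<le> N" for v
    by (rule Td[OF that(1) 1]) (use that in auto)
  have f1: "\<not> c (A + 1)"
    by (rule Td[OF 1 1]) (use bd in \<open>simp_all add: eqs\<close>)
  have t2: "c ((A + 1) * (B + 1))"
    by (rule Fd[OF f1 f1]) (use bd in \<open>simp_all add: eqs\<close>)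
  have f3: "\<not> c (B + 1)"
    using Td[of "B + 1" "B + 1" "(A + 1) * (B + 1)"] t2 bd by (auto simp: eqs)
  have t4: "c (A + 1 + B * (B + 1))"
    by (rule Fd[OF f1 f3]) (use bd in \<open>simp_all add: eqs\<close>)
  have f2: "\<not> c 2"
  proof
    \<comment> \<open>The number 2A + 1 + B(B + 1) is reached both from 2A + 1 and, by adding A,
      from the number in \<open>t4\<close>.\<close>
    assume t: "c 2"
    have "\<not> c (2 * A + 1)"
      by (rule Td[OF 1 t]) (use bd in \<open>simp_all add: eqs\<close>)
    then have "c (2 * A + 1 + B * (B + 1))"
      by (rule Fd[OF _ f3]) (use bd in \<open>simp_all add: eqs\<close>)
    moreover have "\<not> c (A + 1 + B * (B + 1) + A)"
      by (rule TA[OF t4]) (use bd in \<open>simp_all add: eqs\<close>)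
    ultimately show False
      by (simp add: algebra_simps)
  qed
  have F2B: "c (v + 2 * B)" if "\<not> c v" "1 \<le> v" "v + 2 * B \<le> N" for v
    by (rule Fd[OF that(1) f2]) (use that in auto)
  show False
  proof (cases "B = 2")
    case True
    \<comment> \<open>7 = 3 + 2B, and \<open>t4\<close> says that 7 + A has the first colour
      too.\<close>
    have "c 7"
      using F2B[OF f3] AB by (simp add: N True)
    then show False
      using TA[of 7] t4 AB by (simp add: N True algebra_simps)
  next
    case False
    then have B: "3 \<le> B" using AB by simp
    have P: "3 * A \<le> Q" "3 * B \<le> Q"
      using AB B mult_left_mono[of 3 B A] mult_right_mono[of 3 A B] by (auto simp: Q)
    note bd = N' P AB B
    \<comment> \<open>The routes +A, +2B and +2B, +A would end in different colours.\<close>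
    have FA: "c (v + A)" if v: "\<not> c v" "1 \<le> v" "v + 2 * B + A \<le> N" for v
    proof (rule ccontr)
      assume "\<not> c (v + A)"
      then have "c (v + A + 2 * B)"
        using v AB by (intro F2B) auto
      moreover have "c (v + 2 * B)"
        using v AB by (intro F2B) auto
      then have "\<not> c (v + 2 * B + A)"
        using v AB by (intro TA) auto
      ultimately show False
        by (simp add: algebra_simps)
    qed
    \<comment> \<open>Colours alternate along A + 1, 2A + 1, 3A + 1, 4A + 1, and the last is 1 + A *
      4. The shift to it requires 4A + 1 + 2B \<le> N, equivalent to
      \<open>3 * A \<le> Q\<close>.\<close>
    have "c (A + 1 + A)"
      by (rule FA[OF f1]) (use bd in \<open>simp_all add: eqs\<close>)
    then have "\<not> c (A + 1 + A + A)"
      by (rule TA) (use bd in \<open>simp_all add: eqs\<close>)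
    then have "c (A + 1 + A + A + A)"
      by (rule FA) (use bd in \<open>simp_all add: eqs\<close>)
    then have f4: "\<not> c 4"
      using Td[OF 1, of 4 "4 * A + 1"] bd by (auto simp: eqs)
    have t: "c (2 + 4 * B)"
      by (rule Fd[OF f2 f4]) (use bd in \<open>simp_all add: eqs\<close>)
    have "\<not> c (2 + 4 * B + A)"
      by (rule TA[OF t]) (use bd in \<open>simp_all add: eqs\<close>)
    moreover have "c (2 + 2 * B)"
      by (rule F2B[OF f2]) (use bd in \<open>simp_all add: eqs\<close>)
    then have "\<not> c (2 + 2 * B + A)"
      by (rule TA) (use bd in \<open>simp_all add: eqs\<close>)
    then have "c (2 + 2 * B + A + 2 * B)"
      by (rule F2B) (use bd in \<open>simp_all add: eqs\<close>)
    ultimately show False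
      by (simp add: algebra_simps)
  qed
qed

lemma not_avoids_both_Schur:
  fixes A :: int
  assumes A: "1 \<le> A" and N: "N = 2 * A + 2 * ((A + 1) div 2) + 1"
    and T: "avoids N A c" and F: "avoids N 1 (\<lambda>v. \<not> c v)"
  shows False
proof -
  define m where "m = (A + 1) div 2"
  have m: "1 \<le> m" "N = 2 * A + 2 * m + 1"
    using A by (auto simp: m_def N)
  note Td = avoidsD[OF T] and Fd = avoidsD[OF F, simplified not_not]
  show False
  proof (cases "c 1")
    case True
    \<comment> \<open>The forced values end in a clash at A + 4, which is both (A + 1) + 3 and 4 + A
      * 1.\<close>
    have f1: "\<not> c (A + 1)"
      by (rule Td[OF True True]) (use A m in auto)
    have t2: "c (2 * A + 2)"
      by (rule Fd[OF f1 f1]) (use A m in auto)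
    have f2: "\<not> c 2"
      using Td[of 2 2 "2 * A + 2"] t2 A m by auto
    have t4: "c 4"
      by (rule Fd[OF f2 f2]) (use A m in auto)
    have "c (A + 3)"
      by (rule Fd[OF f1 f2]) (use A m in auto)
    then have f3: "\<not> c 3"
      using Td[OF _ True, of 3 "A + 3"] A m by auto
    have "c (A + 4)"
      by (rule Fd[OF f1 f3]) (use A m in auto)
    then show False
      using Td[OF t4 True, of "A + 4"] A m by auto
  next
    case False
    have t2: "c 2"
      by (rule Fd[OF False False]) (use A m in auto)
    \<comment> \<open>Colours alternate along 2j + 1, 2j + 2, 2j + 2 + 2A, 2j + 3 + 2A, and the last
      equals (2j + 3) + A * 2, which forces 2j + 3. For j + 1 = m the last value is exactly
      \<open>N\<close>.\<close>
    have odd_second: "\<not> c (2 * int j + 1)" if "int j \<le> m" for j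
      using that
    proof (induction j)
      case 0
      then show ?case using False by simp
    next
      case (Suc j)
      then have IH: "\<not> c (2 * int j + 1)" by simp
      have "c (2 * int j + 2)"
        by (rule Fd[OF IH False]) (use A m Suc.prems in auto)
      then have "\<not> c (2 * int j + 2 + 2 * A)"
        by (rule Td[OF _ t2]) (use A m Suc.prems in auto)
      then have "c (2 * int j + 3 + 2 * A)"
        by (rule Fd[OF _ False]) (use A m Suc.prems in auto)
      then show ?case
        using Td[OF _ t2, of "2 * int j + 3" "2 * int j + 3 + 2 * A"] A m Suc.prems
        by (auto simp: algebra_simps)
    qed
    have f: "\<not> c (2 * m + 1)"
      using odd_second[of "nat m"] m by simp
    \<comment> \<open>This odd number is chosen to complement 2m + 1 to 2A + 2 = 2 + A * 2; rounding
      up in \<open>m\<close> ensures A - m \<le> m.\<close>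
    have g: "\<not> c (2 * (A - m) + 1)"
    proof -
      have "0 \<le> A - m" "A - m \<le> m"
        using A by (simp_all add: m_def)
      then show ?thesis
        using odd_second[of "nat (A - m)"] by simp
    qed
    have "c (2 * A + 2)"
      by (rule Fd[OF f g]) (use A m in \<open>auto simp: m_def\<close>)
    moreover have "\<not> c (2 * A + 2)"
      by (rule Td[OF t2 t2]) (use A m in auto)
    ultimately show False by simp
  qed
qed

section \<open>Return to arbitrarily many variables\<close>

lemma avoids_if_not_has_sol:
  assumes "\<not> has_sol k a N P" and A: "A = (\<Sum>i=1..k. a i)" "A \<ge> 1"
  shows "avoids (int N) (int A) P"
  unfolding avoids_def
proof (intro allI impI notI, elim conjE)
  fix x y
  assume xy: "1 \<le> x" "1 \<le> y" "x + int A * y \<le> int N" "P x" "P y" "P (x + int A * y)"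
  have sum: "(\<Sum>i=1..k. int (a i) * y) = int A * y"
    by (simp add: sum_distrib_right A(1))
  \<comment> \<open>This supplies the bound y \<le> N, which \<open>avoids\<close> leaves
    implicit.\<close>
  have "y \<le> int A * y"
    using xy(2) A(2) mult_right_mono[of 1 "int A" y] by simp
  then have "x \<le> int N" "1 \<le> x + int A * y" "y \<le> int N"
    using xy by linarith+
  then have "\<forall>v\<in>{x, x + int A * y} \<union> (\<lambda>_. y) ` {1..k}. 1 \<le> v \<and> v \<le> int N \<and> P v"
    using xy by auto
  then have "has_sol k a N P"
    unfolding has_sol_def sum[symmetric] by (intro exI)
  then show False using assms by simp
qed

lemma rado_property_sum_eqI:
  assumes "A = (\<Sum>i=1..k. a i)" "A \<ge> 1" "B = (\<Sum>i=1..l. b i)" "B \<ge> 1"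
    and "\<And>c. avoids (int N) (int A) c \<Longrightarrow> avoids (int N) (int B) (\<lambda>v. \<not> c v) \<Longrightarrow> False"
  shows "rado_property (sum_eq k a) (sum_eq l b) N"
  unfolding rado_property_sum_eq_iff using assms avoids_if_not_has_sol by blast

theorem corollary3p2:
  fixes k l :: nat and a b :: "nat \<Rightarrow> nat"
  assumes "k \<ge> 1" and "l \<ge> 1"
    and "\<And>i. i \<in> {1..k} \<Longrightarrow> a i > 0"
    and "\<And>i. i \<in> {1..l} \<Longrightarrow> b i > 0"
    and "(\<Sum>i=1..k. a i) \<ge> (\<Sum>i=1..l. b i)"
  shows "RR (sum_eq k a) (sum_eq l b) =
    Some (if (\<Sum>i=1..l. b i) = 1
          then 2 * (\<Sum>i=1..k. a i) + 2 * (((\<Sum>i=1..k. a i) + 1) div 2) + 1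
          else ((\<Sum>i=1..k. a i) + 1) * ((\<Sum>i=1..l. b i) + 1) + (\<Sum>i=1..l. b i))"
proof -
  define A B where AB_def: "A = (\<Sum>i=1..k. a i)" "B = (\<Sum>i=1..l. b i)"
  have "b 1 \<le> B"
    unfolding AB_def using assms(2) by (intro member_le_sum) auto
  then have B: "1 \<le> B" "B \<le> A"
    using assms(2,5) assms(4)[of 1] by (auto simp: AB_def)
  show ?thesis
  proof (cases "B = 1")
    case True
    \<comment> \<open>Positive coefficients with sum 1 leave a single y, so the second equation is
      Schur's x + y = z.\<close>
    have "(\<Sum>i=1..l. 1) \<le> B"
      unfolding AB_def using assms(4) by (intro sum_mono) (simp add: Suc_leI)
    then have l: "l = 1"
      using True assms(2) by simp
    then have "b 1 = 1"
      using True AB_def by simp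
    have "RR (sum_eq k a) (sum_eq l b) = Some (2 * A + 2 * ((A + 1) div 2) + 1)"
    proof (rule RR_eqI)
      have "False" if "avoids (int (2 * A + 2 * ((A + 1) div 2) + 1)) (int A) c"
        "avoids (int (2 * A + 2 * ((A + 1) div 2) + 1)) (int B) (\<lambda>v. \<not> c v)" for c
        using not_avoids_both_Schur[OF _ _ that[unfolded True of_nat_1]] B
        by (simp add: zdiv_int algebra_simps)
      then show "rado_property (sum_eq k a) (sum_eq l b) (2 * A + 2 * ((A + 1) div 2) + 1)"
        by (intro rado_property_sum_eqI[OF AB_def(1) _ AB_def(2)]) (use B in \<open>linarith | blast\<close>)+
    qed (use rado_property_ge_Schur assms(1,3) l \<open>b 1 = 1\<close> AB_def in blast)
    then show ?thesis
      using True by (simp add: AB_def)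
  next
    case False
    have "RR (sum_eq k a) (sum_eq l b) = Some ((A + 1) * (B + 1) + B)"
    proof (rule RR_eqI)
      have "False" if "avoids (int ((A + 1) * (B + 1) + B)) (int A) c"
        "avoids (int ((A + 1) * (B + 1) + B)) (int B) (\<lambda>v. \<not> c v)" for c
        using not_avoids_both_one_first[OF _ _ _ that] not_avoids_both_one_second[OF _ _ _ that] B False
        by (cases "c 1") (auto simp: algebra_simps)
      then show "rado_property (sum_eq k a) (sum_eq l b) ((A + 1) * (B + 1) + B)"
        by (intro rado_property_sum_eqI[OF AB_def(1) _ AB_def(2)]) (use B in \<open>linarith | blast\<close>)+
    qed (use rado_property_ge assms(4) B AB_def in blast)
    then show ?thesis
      using False by (simp add: AB_def)
  qed
qed

end
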